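(* Let $G_0$ be the background Green's function for the diffusion equation with uniform absorption $\alpha_0$. Suppose that the potential $\eta$ consists of $m$ identical point absorbers of strength $\kappa>0$ located at the (distinct) vertices $\Lambda=\{x_{k_1},\dots,x_{k_m}\}\subset V$, i.e. $\eta=\kappa\sum_{l=1}^m\delta_{x_{k_l}}$. Let $I_\Lambda$ be the $(|V|+|\delta V|)\times m$ submatrix of the identity matrix obtained by taking the columns indexed by $\Lambda$. Then the Green's function $G$ of the diffusion equation with absorption $\alpha_0(1+\eta)$ satisfies $$G_0-G=\alpha_0\kappa\,G_0I_\Lambda\left[I+\alpha_0\kappa\,I_\Lambda^TG_0I_\Lambda\right]^{-1}I_\Lambda^TG_0.$$
   Context: Let $\Gamma=(V',E)$ be a connected, locally finite, loop-free (undirected, simple) graph and let $V\subsetneq V'$ be a nonempty proper subset. Its vertex boundary is $\delta V=\{y\in V'\setminus V:\exists x\in V,\ x\sim y\}$, where $x\sim y$ means adjacency. Assume $n=|V|$ and $k=|\delta V|$ are finite. Let $\Sigma$ be the graph on $V\cup\delta V$ whose edges are the edges of $\Gamma$ joining two vertices of $V\cup\delta V$ at least one of which lies in $V$, and let $L$ be its combinatorial Laplacian matrix (degree in $\Sigma$ on the diagonal, $-1$ for adjacent pairs, $0$ otherwise). With vertices of $V$ listed first, for $\alpha_0>0$ and $0\le t<\infty$ put $$H_0=L+\begin{pmatrix}\alpha_0I_{n\times n}&0\\0&t\,I_{k\times k}\end{pmatrix},$$ assumed invertible; the background Green's function is $G_0=H_0^{-1}$. For $\eta\ge0$ supported in $V$,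 let $D_\eta$ be the diagonal matrix with entries $\eta(x)$; the Green's function of the diffusion equation with absorption $\alpha_0(1+\eta)$ is $G=H^{-1}$, where $H=H_0+\alpha_0D_\eta$. The function $\delta_x$ equals $1$ at $x$ and $0$ elsewhere; $I$ inside the bracket is the $m\times m$ identity matrix. *)

theory Defs
  imports
    Complex_Main
    "HOL-Library.Indicator_Function"
    "Graph_Theory.Graph_Theory"
    "Jordan_Normal_Form.Gauss_Jordan_Elimination"
begin

text \<open>An undirected simple graph is a symmetric loop-free digraph without parallel arcs
  (\<^locale>\<open>pair_bidirected_digraph\<close>); finiteness of the vertex set is not required, and every
  edge is represented by its two opposite arcs.\<close>

definition locally_finite :: "'a pair_pre_digraph \<Rightarrow> bool" where
  "locally_finite \<Gamma> \<longleftrightarrow> (\<forall>x \<in> pverts \<Gamma>. finite (out_arcs (with_proj \<Gamma>) x))"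

definition vertex_boundary :: "'a pair_pre_digraph \<Rightarrow> 'a set \<Rightarrow> 'a set" where
  "vertex_boundary \<Gamma> V = {y \<in> pverts \<Gamma> - V. \<exists>x \<in> V. x \<rightarrow>\<^bsub>with_proj \<Gamma>\<^esub> y}"

text \<open>The graph on the vertices of \<open>V\<close> and its boundary; edges between two boundary vertices
  are dropped.\<close>

definition boundary_subgraph :: "'a pair_pre_digraph \<Rightarrow> 'a set \<Rightarrow> 'a pair_pre_digraph" where
  "boundary_subgraph \<Gamma> V =
     \<lparr> pverts = V \<union> vertex_boundary \<Gamma> V,
       parcs = {(x, y) \<in> parcs \<Gamma>.
          x \<in> V \<union> vertex_boundary \<Gamma> V \<and> y \<in> V \<union> vertex_boundary \<Gamma> V \<and> (x \<in> V \<or> y \<in> V)} \<rparr>"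

text \<open>Rows and columns are indexed by positions in the list \<open>vs\<close> of vertices. In a symmetric
  digraph the number of arcs leaving a vertex is its degree as a vertex of the undirected graph.\<close>

definition laplacian_mat :: "'a pair_pre_digraph \<Rightarrow> 'a list \<Rightarrow> real mat" where
  "laplacian_mat G vs = mat (length vs) (length vs) (\<lambda>(i, j).
     if i = j then real (out_degree (with_proj G) (vs ! i))
     else if vs ! i \<rightarrow>\<^bsub>with_proj G\<^esub> vs ! j then - 1 else 0)"

text \<open>\<open>xs\<close> lists \<open>V\<close> and \<open>ys\<close> lists the boundary of \<open>V\<close>.\<close>

definition background_operator ::
    "'a pair_pre_digraph \<Rightarrow> 'a list \<Rightarrow> 'a list \<Rightarrow> real \<Rightarrow> real \<Rightarrow> real mat" where
  "background_operator \<Gamma> xs ys \<alpha>\<^sub>0 t =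
     laplacian_mat (boundary_subgraph \<Gamma> (set xs)) (xs @ ys) +
     four_block_mat (\<alpha>\<^sub>0 \<cdot>\<^sub>m 1\<^sub>m (length xs)) (0\<^sub>m (length xs) (length ys))
                    (0\<^sub>m (length ys) (length xs)) (t \<cdot>\<^sub>m 1\<^sub>m (length ys))"

definition potential_mat :: "'a list \<Rightarrow> ('a \<Rightarrow> real) \<Rightarrow> real mat" where
  "potential_mat vs \<eta> = mat_diag (length vs) (\<lambda>i. \<eta> (vs ! i))"

definition identity_cols :: "nat \<Rightarrow> nat list \<Rightarrow> real mat" where
  "identity_cols N ks = mat_of_cols N (map (col (1\<^sub>m N)) ks)"

text \<open>Only meaningful for invertible matrices; see the lemma below.\<close>

definition inverse_mat :: "real mat \<Rightarrow> real mat" where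
  "inverse_mat A = the (mat_inverse A)"

lemma inverse_mat:
  assumes A: "A \<in> carrier_mat n n" and inv: "invertible_mat A"
  shows "inverse_mat A \<in> carrier_mat n n"
    and "A * inverse_mat A = 1\<^sub>m n"
    and "inverse_mat A * A = 1\<^sub>m n"
proof -
  from inv obtain B where AB: "A * B = 1\<^sub>m n" and BA: "B * A = 1\<^sub>m (dim_row B)"
    using A unfolding invertible_mat_def inverts_mat_def by auto
  have "dim_col B = n" using arg_cong[OF AB, of dim_col] by simp
  moreover have "dim_row B = n" using arg_cong[OF BA, of dim_col] A by simp
  ultimately have B: "B \<in> carrier_mat n n" by auto
  have "A \<in> Units (ring_mat TYPE(real) n ())"
    using A B AB BA unfolding Units_def by (auto simp: ring_mat_simps)
  then obtain C where C: "mat_inverse A = Some C"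
    using mat_inverse(1)[OF A, of "()"] by (cases "mat_inverse A") auto
  from mat_inverse(2)[OF A C] C show "inverse_mat A \<in> carrier_mat n n"
    and "A * inverse_mat A = 1\<^sub>m n" and "inverse_mat A * A = 1\<^sub>m n"
    unfolding inverse_mat_def by auto
qed

end

theory Submission
  imports Defs "Jordan_Normal_Form.Determinant"
begin

text \<open>Let \<open>w\<close> be in the kernel of \<open>H\<close>. The quadratic form of \<open>H\<close> at \<open>w\<close> is the Dirichlet
  energy of \<open>w\<close> plus \<open>\<alpha>\<^sub>0 (1 + \<eta>)\<close> and \<open>t\<close> times squares of entries of \<open>w\<close>, so \<open>w\<close> vanishes on
  \<open>V\<close>; as \<open>\<eta>\<close> is supported in \<open>V\<close>, also \<open>H\<^sub>0 w = 0\<close>, whence \<open>w = 0\<close>. So \<open>H\<close> is invertible. Since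
  \<open>H\<close> differs from \<open>H\<^sub>0\<close> by \<open>\<alpha>\<^sub>0 \<kappa> I\<^sub>\<Lambda> I\<^sub>\<Lambda>\<^sup>T\<close>, the formula is the Woodbury identity.\<close>

section \<open>Invertibility and trivial kernel\<close>

lemma invertible_matI:
  assumes "A \<in> carrier_mat n n" and "B \<in> carrier_mat n n"
    and "A * B = 1\<^sub>m n" and "B * A = 1\<^sub>m n"
  shows "invertible_mat A"
  using assms unfolding invertible_mat_def inverts_mat_def by auto

text \<open>The determinant links the two sides: a trivial kernel makes it nonzero, and then
  \<open>A\<close> is a unit of the ring of n x n matrices. Conversely, a left inverse annihilates
  the kernel.\<close>

lemma invertible_mat_iff_kernel_trivial:
  fixes A :: "'a :: field mat"
  assumes A: "A \<in> carrier_mat n n"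
  shows "invertible_mat A \<longleftrightarrow> (\<forall>v \<in> carrier_vec n. A *\<^sub>v v = 0\<^sub>v n \<longrightarrow> v = 0\<^sub>v n)"
proof
  assume "invertible_mat A"
  then obtain B where AB: "A * B = 1\<^sub>m n" and BA: "B * A = 1\<^sub>m (dim_row B)"
    using A unfolding invertible_mat_def inverts_mat_def by auto
  \<comment> \<open>Invertibility as defined does not fix the shape of \<open>B\<close>; comparing
    the column counts of both products with those of the identities does.\<close>
  have B: "B \<in> carrier_mat n n"
    using arg_cong[OF AB, of dim_col] arg_cong[OF BA, of dim_col] A by auto
  show "\<forall>v \<in> carrier_vec n. A *\<^sub>v v = 0\<^sub>v n \<longrightarrow> v = 0\<^sub>v n"
  proof (intro ballI impI)
    fix v :: "'a vec" assume v: "v \<in> carrier_vec n" and "A *\<^sub>v v = 0\<^sub>v n"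
    then have "B * A *\<^sub>v v = B *\<^sub>v 0\<^sub>v n" using A B by simp
    also have "\<dots> = 0\<^sub>v n" using B by (intro eq_vecI) auto
    finally have "B * A *\<^sub>v v = 0\<^sub>v n" .
    then show "v = 0\<^sub>v n" using BA B v by simp
  qed
next
  assume "\<forall>v \<in> carrier_vec n. A *\<^sub>v v = 0\<^sub>v n \<longrightarrow> v = 0\<^sub>v n"
  then have "det A \<noteq> 0" using det_0_iff_vec_prod_zero[OF A] by blast
  from det_non_zero_imp_unit[OF A this, of "()"]
  obtain B where "B \<in> carrier_mat n n" "A * B = 1\<^sub>m n" "B * A = 1\<^sub>m n"
    unfolding Units_def by (auto simp: ring_mat_simps)
  then show "invertible_mat A" using A by (intro invertible_matI)
qed

section \<open>The Woodbury identity\<close>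

text \<open>With P and Q the inverses of \<open>A\<close> and \<open>A + U * W\<close>, everything
  rests on the resolvent identity P = Q + P U W Q. Multiplied by W from the left it becomes M (W Q)
  = W P. This yields both an explicit inverse of M and, after cancelling M, the expression for W Q
  that is put back into P - Q = P U (W Q).\<close>

lemma woodbury:
  assumes A: "A \<in> carrier_mat n n" and U: "U \<in> carrier_mat n m" and W: "W \<in> carrier_mat m n"
    and invA: "invertible_mat A" and invB: "invertible_mat (A + U * W)"
  defines "M \<equiv> 1\<^sub>m m + W * inverse_mat A * U"
  shows "invertible_mat M"
    and "inverse_mat A - inverse_mat (A + U * W) =
      inverse_mat A * U * inverse_mat M * W * inverse_mat A"
proof -
  define P where "P = inverse_mat A"
  define Q where "Q = inverse_mat (A + U * W)"
  have B: "A + U * W \<in> carrier_mat n n" using A U W by simp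
  have P: "P \<in> carrier_mat n n" and PA: "P * A = 1\<^sub>m n"
    unfolding P_def using inverse_mat[OF A invA] by auto
  have Q: "Q \<in> carrier_mat n n" and BQ: "(A + U * W) * Q = 1\<^sub>m n"
    unfolding Q_def using inverse_mat[OF B invB] by auto
  have M: "M \<in> carrier_mat m m" using P U W unfolding M_def P_def by simp
  have WQ: "W * Q \<in> carrier_mat m n" using W Q by simp
  have PU: "P * U \<in> carrier_mat n m" using P U by simp
  \<comment> \<open>Inserting the identity as \<open>(A + U * W) * Q\<close> and expanding gives the
    resolvent identity.\<close>
  have "P = P * ((A + U * W) * Q)" using BQ P by simp
  also have "\<dots> = P * (A * Q + U * W * Q)"
    using A U W Q by (simp add: add_mult_distrib_mat[of A n n])
  also have "\<dots> = P * (A * Q) + P * (U * W * Q)"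
    using A U W Q P by (intro mult_add_distrib_mat[of _ n n]) auto
  also have "P * (A * Q) = Q"
    using assoc_mult_mat[OF P A Q] PA Q by simp
  also have "P * (U * W * Q) = P * U * (W * Q)"
    using assoc_mult_mat[OF U W Q] assoc_mult_mat[OF P U WQ] by simp
  finally have P_eq: "P = Q + P * U * (W * Q)" .
  have "M * (W * Q) = W * Q + W * P * U * (W * Q)"
    using add_mult_distrib_mat[of "1\<^sub>m m" m m "W * P * U" "W * Q" n] W P U Q
    unfolding M_def P_def[symmetric] by auto
  also have "W * P * U * (W * Q) = W * (P * U * (W * Q))"
    using assoc_mult_mat[OF W P U] assoc_mult_mat[OF W PU WQ] by simp
  also have "W * Q + W * (P * U * (W * Q)) = W * (Q + P * U * (W * Q))"
    using mult_add_distrib_mat[OF W Q, of "P * U * (W * Q)"] PU WQ by simp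
  also have "\<dots> = W * P" using P_eq by simp
  finally have MWQ: "M * (W * Q) = W * P" .

  have WQU: "W * Q * U \<in> carrier_mat m m" using WQ U by simp
  \<comment> \<open>The witness \<open>1\<^sub>m m - W * Q * U\<close> inverts \<open>M\<close>
    because \<open>MWQ\<close> turns \<open>M * (W * Q * U)\<close> into \<open>W * P * U\<close>,
    which is \<open>M\<close> minus the identity.\<close>
  have "M * (1\<^sub>m m - W * Q * U) = M - M * (W * Q * U)"
    using mult_minus_distrib_mat[OF M, of "1\<^sub>m m" m "W * Q * U"] WQU M by simp
  also have "M * (W * Q * U) = W * P * U"
    using assoc_mult_mat[OF M WQ U] MWQ by simp
  also have "M - W * P * U = 1\<^sub>m m"
    unfolding M_def P_def[symmetric] using W P U by (intro eq_matI) auto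
  finally have MN: "M * (1\<^sub>m m - W * Q * U) = 1\<^sub>m m" .
  have N: "1\<^sub>m m - W * Q * U \<in> carrier_mat m m" using WQU by (rule minus_carrier_mat)
  \<comment> \<open>For square matrices a right inverse is also a left inverse.\<close>
  show inv: "invertible_mat M"
    using invertible_matI[OF M N MN mat_mult_left_right_inverse[OF M N MN]] .
  define R where "R = inverse_mat M"
  have R: "R \<in> carrier_mat m m" and RM: "R * M = 1\<^sub>m m"
    unfolding R_def using inverse_mat[OF M inv] by auto
  have "W * Q = R * M * (W * Q)" using RM left_mult_one_mat[OF WQ] by simp
  also have "\<dots> = R * (W * P)" using assoc_mult_mat[OF R M WQ] MWQ by simp
  finally have WQ_eq: "W * Q = R * (W * P)" .
  have WP: "W * P \<in> carrier_mat m n" using W P by simp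
  \<comment> \<open>Q is moved across \<open>P_eq\<close> entry by entry. As P recurs on the right
    of \<open>P_eq\<close>, it is substituted just once.\<close>
  have "P - Q = P * U * (W * Q)"
  proof (rule eq_matI)
    fix i j assume "i < dim_row (P * U * (W * Q))" and "j < dim_col (P * U * (W * Q))"
    then have ij: "i < n" "j < n" using P Q by auto
    then have "P $$ (i, j) = Q $$ (i, j) + (P * U * (W * Q)) $$ (i, j)"
      by (subst P_eq) (use P Q U W in \<open>simp\<close>)
    then show "(P - Q) $$ (i, j) = (P * U * (W * Q)) $$ (i, j)" using ij P Q by simp
  qed (use P Q in auto)
  also have "\<dots> = P * U * R * W * P"
    using WQ_eq assoc_mult_mat[OF PU R WP] assoc_mult_mat[OF _ W P, of "P * U * R" n] PU R by simp
  finally show "inverse_mat A - inverse_mat (A + U * W) =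
      inverse_mat A * U * inverse_mat M * W * inverse_mat A"
    unfolding P_def Q_def R_def .
qed

section \<open>The Laplacian and its Dirichlet form\<close>

text \<open>The condition that an endpoint lies in \<open>V\<close> is symmetric in the two
  endpoints, and restricting the arcs creates no loops.\<close>

lemma pair_bidirected_boundary_subgraph:
  assumes "pair_bidirected_digraph \<Gamma>"
  shows "pair_bidirected_digraph (boundary_subgraph \<Gamma> V)"
proof -
  interpret pair_bidirected_digraph \<Gamma> by fact
  have "sym (parcs \<Gamma>)" using pair_sym_arcs by (simp add: symmetric_def)
  then have "sym (parcs (boundary_subgraph \<Gamma> V))"
    unfolding boundary_subgraph_def sym_def by auto
  then show ?thesis
    by unfold_locales (auto simp: boundary_subgraph_def symmetric_def dest: pair_no_loops)
qed

text \<open>Since \<open>vs\<close> enumerates the vertices, its positions correspond one to one to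
  possible heads of arcs leaving \<open>v\<close>. As a sum over positions, the degree can be merged
  with the off-diagonal part of a Laplacian row.\<close>

lemma out_degree_eq_sum:
  assumes "pair_wf_digraph G" and "distinct vs" and "set vs = pverts G"
  shows "real (out_degree (with_proj G) v) =
    (\<Sum>j<length vs. of_bool ((v, vs ! j) \<in> parcs G))"
proof -
  interpret pair_wf_digraph G by fact
  have inj: "inj_on ((!) vs) {..<length vs}"
    using assms(2) by (simp add: inj_on_nth)
  have "out_arcs (with_proj G) v = (\<lambda>j. (v, vs ! j)) ` {j. j < length vs \<and> (v, vs ! j) \<in> parcs G}"
    (is "_ = _ ` ?J")
  proof
    show "out_arcs (with_proj G) v \<subseteq> (\<lambda>j. (v, vs ! j)) ` ?J"
    proof
      fix e assume "e \<in> out_arcs (with_proj G) v"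
      then have e: "(v, snd e) \<in> parcs G" "e = (v, snd e)" by auto
      then have "snd e \<in> set vs" using assms(3) in_arcsD2 by auto
      then obtain j where "j < length vs" "vs ! j = snd e" by (auto simp: in_set_conv_nth)
      then show "e \<in> (\<lambda>j. (v, vs ! j)) ` ?J" using e by (intro image_eqI[of _ _ j]) auto
    qed
  qed auto
  moreover have "inj_on (\<lambda>j. (v, vs ! j)) ?J"
    using inj by (auto simp: inj_on_def)
  ultimately have "out_degree (with_proj G) v = card ?J"
    unfolding out_degree_def by (simp add: card_image)
  also have "real (card ?J) = (\<Sum>j<length vs. of_bool ((v, vs ! j) \<in> parcs G))"
    by (subst sum_of_bool_eq) (auto intro!: arg_cong[where f = card])
  finally show ?thesis .
qed

lemma laplacian_mat_dim [simp]:
  shows "laplacian_mat G vs \<in> carrier_mat (length vs) (length vs)"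
    and "dim_row (laplacian_mat G vs) = length vs"
    and "dim_col (laplacian_mat G vs) = length vs"
  by (simp_all add: laplacian_mat_def)

text \<open>The diagonal contributes one copy of \<open>w $ i\<close> per neighbour, which pairs
  with the \<open>- w $ j\<close> of that neighbour.\<close>

lemma laplacian_mat_mult_vec:
  assumes "pair_bidirected_digraph G" and "distinct vs" and "set vs = pverts G"
    and w: "w \<in> carrier_vec (length vs)" and i: "i < length vs"
  shows "(laplacian_mat G vs *\<^sub>v w) $ i =
    (\<Sum>j<length vs. of_bool ((vs ! i, vs ! j) \<in> parcs G) * (w $ i - w $ j))"
proof -
  interpret pair_bidirected_digraph G by fact
  let ?a = "\<lambda>j. of_bool ((vs ! i, vs ! j) \<in> parcs G) :: real"
  \<comment> \<open>Degree matrix minus adjacency matrix: subtracting \<open>?a j\<close> is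
    harmless at \<open>j = i\<close>, because there are no loops.\<close>
  have entry: "laplacian_mat G vs $$ (i, j) =
      (if i = j then real (out_degree (with_proj G) (vs ! i)) else 0) - ?a j"
    if "j < length vs" for j
    using that i pair_no_loops[of "(vs ! i, vs ! j)"] by (auto simp: laplacian_mat_def)
  have "(laplacian_mat G vs *\<^sub>v w) $ i = (\<Sum>j<length vs. laplacian_mat G vs $$ (i, j) * w $ j)"
    using i w by (simp add: scalar_prod_def lessThan_atLeast0)
  also have "\<dots> = (\<Sum>j<length vs.
      (if i = j then real (out_degree (with_proj G) (vs ! i)) * w $ j else 0) - ?a j * w $ j)"
    by (intro sum.cong) (simp_all add: entry left_diff_distrib)
  also have "\<dots> = real (out_degree (with_proj G) (vs ! i)) * w $ i - (\<Sum>j<length vs. ?a j * w $ j)"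
    using i by (simp add: sum_subtractf)
  also have "real (out_degree (with_proj G) (vs ! i)) = (\<Sum>j<length vs. ?a j)"
    using out_degree_eq_sum[OF pair_wf_digraph_axioms assms(2,3)] .
  finally show ?thesis
    by (simp add: sum_distrib_right sum_subtractf right_diff_distrib)
qed

text \<open>Twice the form is the sum of \<open>(w $ i - w $ j)\<^sup>2\<close> over ordered
  adjacent pairs.\<close>

lemma laplacian_quadratic_form_nonneg:
  assumes "pair_bidirected_digraph G" and "distinct vs" and "set vs = pverts G"
    and w: "w \<in> carrier_vec (length vs)"
  shows "w \<bullet> (laplacian_mat G vs *\<^sub>v w) \<ge> 0"
proof -
  interpret pair_bidirected_digraph G by fact
  let ?N = "{..<length vs}"
  let ?a = "\<lambda>i j. of_bool ((vs ! i, vs ! j) \<in> parcs G) :: real"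
  have "sym (parcs G)" using pair_sym_arcs by (simp add: symmetric_def)
  then have sym: "?a i j = ?a j i" for i j by (auto simp: sym_def)
  have S: "w \<bullet> (laplacian_mat G vs *\<^sub>v w) = (\<Sum>i\<in>?N. \<Sum>j\<in>?N. ?a i j * (w $ i * (w $ i - w $ j)))"
    (is "?S = _")
    unfolding scalar_prod_def lessThan_atLeast0[symmetric]
    \<comment> \<open>The deleted rules would unfold the product into scalar products and absorb the
      0/1 weights into the index sets.\<close>
    by (simp add: laplacian_mat_mult_vec[OF assms] sum_distrib_left mult.left_commute
        del: index_mult_mat_vec sum_mult_of_bool_eq sum_of_bool_mult_eq)
  \<comment> \<open>Exchanging the roles of i and j gives a second expression for the form; added to
    the first, it completes each summand to a weighted square.\<close>
  also have "\<dots> = (\<Sum>i\<in>?N. \<Sum>j\<in>?N. ?a i j * (w $ j * (w $ j - w $ i)))"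
    by (subst sum.swap) (simp only: sym)
  finally have "2 * ?S = (\<Sum>i\<in>?N. \<Sum>j\<in>?N. ?a i j * (w $ i * (w $ i - w $ j)))
      + (\<Sum>i\<in>?N. \<Sum>j\<in>?N. ?a i j * (w $ j * (w $ j - w $ i)))"
    using S by simp
  also have "\<dots> = (\<Sum>i\<in>?N. \<Sum>j\<in>?N. ?a i j * (w $ i - w $ j)\<^sup>2)"
    unfolding sum.distrib[symmetric]
    by (intro sum.cong refl) (simp add: algebra_simps power2_eq_square)
  also have "\<dots> \<ge> 0" by (intro sum_nonneg) simp
  finally show ?thesis by simp
qed

section \<open>Laplacian plus diagonal: invertibility of \<open>H\<close>\<close>

lemma mat_diag_mult_vec:
  fixes d :: "nat \<Rightarrow> 'a :: semiring_0"
  assumes "w \<in> carrier_vec n"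
  shows "mat_diag n d *\<^sub>v w = vec n (\<lambda>i. d i * w $ i)"
proof (rule eq_vecI)
  fix i assume "i < dim_vec (vec n (\<lambda>i. d i * w $ i))"
  then have i: "i < n" by simp
  have "(mat_diag n d *\<^sub>v w) $ i = (\<Sum>j = 0..<n. (if i = j then d j * w $ j else 0))"
    using i assms by (simp add: mat_diag_def scalar_prod_def if_distrib[of "\<lambda>x. x * _"] cong: if_cong)
  then show "(mat_diag n d *\<^sub>v w) $ i = vec n (\<lambda>i. d i * w $ i) $ i"
    using i by simp
qed (simp add: mat_diag_def)

text \<open>Pairing the kernel equation with \<open>w\<close> gives 0 as the Dirichlet form plus the
  sum of \<open>d i * (w $ i)\<^sup>2\<close>. All terms are nonnegative, so each vanishes; an entry
  of \<open>w\<close> is controlled only where \<open>d\<close> is positive.\<close>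

lemma laplacian_plus_diag_kernel:
  assumes "pair_bidirected_digraph G" and "distinct vs" and "set vs = pverts G"
    and w: "w \<in> carrier_vec (length vs)"
    and d: "\<And>i. i < length vs \<Longrightarrow> d i \<ge> 0"
    and ker: "(laplacian_mat G vs + mat_diag (length vs) d) *\<^sub>v w = 0\<^sub>v (length vs)"
    and i: "i < length vs" "d i > 0"
  shows "w $ i = 0"
proof -
  have L: "laplacian_mat G vs *\<^sub>v w \<in> carrier_vec (length vs)"
    using laplacian_mat_dim(1) w by (rule mult_mat_vec_carrier)
  have "0 = w \<bullet> ((laplacian_mat G vs + mat_diag (length vs) d) *\<^sub>v w)"
    using ker w by simp
  also have "\<dots> = w \<bullet> (laplacian_mat G vs *\<^sub>v w + vec (length vs) (\<lambda>i. d i * w $ i))"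
    using add_mult_distrib_mat_vec[OF laplacian_mat_dim(1) mat_diag_dim w] mat_diag_mult_vec[OF w]
    by simp
  also have "\<dots> = w \<bullet> (laplacian_mat G vs *\<^sub>v w) + (\<Sum>i<length vs. d i * (w $ i)\<^sup>2)"
    using scalar_prod_add_distrib[OF w L, of "vec (length vs) (\<lambda>i. d i * w $ i)"]
    by (simp add: scalar_prod_def lessThan_atLeast0 power2_eq_square mult_ac)
  finally have "(\<Sum>i<length vs. d i * (w $ i)\<^sup>2) \<le> 0"
    using laplacian_quadratic_form_nonneg[OF assms(1-4)] by linarith
  moreover have "d i * (w $ i)\<^sup>2 \<le> (\<Sum>i<length vs. d i * (w $ i)\<^sup>2)"
    using i d by (intro member_le_sum) auto
  ultimately have "d i * (w $ i)\<^sup>2 \<le> 0" by linarith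
  then show ?thesis using i(2) by (simp add: mult_le_0_iff)
qed

text \<open>Written as one diagonal matrix, the block term can later be merged with the
  potential.\<close>

lemma background_operator_eq:
  "background_operator \<Gamma> xs ys \<alpha> t =
    laplacian_mat (boundary_subgraph \<Gamma> (set xs)) (xs @ ys) +
    mat_diag (length (xs @ ys)) (\<lambda>i. if i < length xs then \<alpha> else t)"
proof -
  have "four_block_mat (\<alpha> \<cdot>\<^sub>m 1\<^sub>m (length xs)) (0\<^sub>m (length xs) (length ys))
      (0\<^sub>m (length ys) (length xs)) (t \<cdot>\<^sub>m 1\<^sub>m (length ys)) =
    mat_diag (length (xs @ ys)) (\<lambda>i. if i < length xs then \<alpha> else t)"
    by (rule eq_matI) (auto simp: mat_diag_def)
  then show ?thesis by (simp add: background_operator_def)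
qed

lemma invertible_background_plus_potential:
  assumes "pair_bidirected_digraph \<Gamma>"
    and "distinct xs" and "distinct ys" and "set ys = vertex_boundary \<Gamma> (set xs)"
    and "\<alpha> > 0" and "t \<ge> 0"
    and inv: "invertible_mat (background_operator \<Gamma> xs ys \<alpha> t)"
    and nonneg: "\<And>x. \<eta> x \<ge> 0" and supp: "\<And>x. x \<notin> set xs \<Longrightarrow> \<eta> x = 0"
  shows "invertible_mat (background_operator \<Gamma> xs ys \<alpha> t + \<alpha> \<cdot>\<^sub>m potential_mat (xs @ ys) \<eta>)"
proof -
  let ?vs = "xs @ ys" and ?G = "boundary_subgraph \<Gamma> (set xs)"
  let ?N = "length ?vs" and ?L = "laplacian_mat ?G ?vs"
  \<comment> \<open>\<open>d\<^sub>0\<close> and \<open>d\<close> are the diagonals that the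
    operators without and with the potential add to the same Laplacian.\<close>
  define d\<^sub>0 where "d\<^sub>0 i = (if i < length xs then \<alpha> else t)" for i
  define d where "d i = d\<^sub>0 i + \<alpha> * \<eta> (?vs ! i)" for i
  have disj: "set xs \<inter> set ys = {}"
    using assms(4) by (auto simp: vertex_boundary_def)
  have G: "pair_bidirected_digraph ?G"
    using assms(1) by (rule pair_bidirected_boundary_subgraph)
  have vs: "distinct ?vs" "set ?vs = pverts ?G"
    using assms(2-4) disj by (auto simp: boundary_subgraph_def)
  have \<eta>_boundary: "\<eta> (?vs ! i) = 0" if "i < ?N" "\<not> i < length xs" for i
  proof -
    have "?vs ! i \<in> set ys" using that by (simp add: nth_append)
    then show ?thesis using supp disj by blast
  qed
  have B: "background_operator \<Gamma> xs ys \<alpha> t = ?L + mat_diag ?N d\<^sub>0"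
    by (simp add: background_operator_eq d\<^sub>0_def [abs_def])
  have L: "?L \<in> carrier_mat ?N ?N" by (rule laplacian_mat_dim(1))
  have D: "mat_diag ?N f \<in> carrier_mat ?N ?N" for f :: "nat \<Rightarrow> real" by (rule mat_diag_dim)
  have "mat_diag ?N d\<^sub>0 + \<alpha> \<cdot>\<^sub>m potential_mat ?vs \<eta> = mat_diag ?N d"
    by (rule eq_matI) (auto simp: potential_mat_def mat_diag_def d_def)
  then have H: "background_operator \<Gamma> xs ys \<alpha> t + \<alpha> \<cdot>\<^sub>m potential_mat ?vs \<eta> = ?L + mat_diag ?N d"
    unfolding B using assoc_add_mat[OF L D, of "\<alpha> \<cdot>\<^sub>m potential_mat ?vs \<eta>" d\<^sub>0]
    by (simp add: potential_mat_def)
  have LD: "?L + mat_diag ?N f \<in> carrier_mat ?N ?N" for f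
    using L D by simp
  have trivial: "w = 0\<^sub>v ?N"
    if w: "w \<in> carrier_vec ?N" and ker: "(?L + mat_diag ?N d) *\<^sub>v w = 0\<^sub>v ?N" for w
  proof -
    have "d i \<ge> 0" for i
      using assms(5,6) nonneg by (simp add: d_def d\<^sub>0_def)
    \<comment> \<open>At boundary positions the diagonal is \<open>t\<close>, possibly 0, so the
      quadratic form is used on positions of \<open>V\<close> only.\<close>
    moreover have "d i > 0" if "i < length xs" for i
      using that assms(5) nonneg by (simp add: d_def d\<^sub>0_def add_pos_nonneg)
    ultimately have zero: "w $ i = 0" if "i < length xs" for i
      using laplacian_plus_diag_kernel[OF G vs w _ ker, of i] that by simp
    \<comment> \<open>Where the two diagonals may differ, on \<open>V\<close>, the vector is zero;
      on the boundary they coincide.\<close>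
    have "d i * w $ i = d\<^sub>0 i * w $ i" if "i < ?N" for i
      using that zero \<eta>_boundary by (cases "i < length xs") (simp_all add: d_def)
    then have "mat_diag ?N d *\<^sub>v w = mat_diag ?N d\<^sub>0 *\<^sub>v w"
      unfolding mat_diag_mult_vec[OF w] by (intro eq_vecI) auto
    then have "(?L + mat_diag ?N d\<^sub>0) *\<^sub>v w = 0\<^sub>v ?N"
      using ker unfolding add_mult_distrib_mat_vec[OF L D w] by simp
    then show ?thesis
      using inv w unfolding B invertible_mat_iff_kernel_trivial[OF LD] by blast
  qed
  then show ?thesis
    unfolding H invertible_mat_iff_kernel_trivial[OF LD] by blast
qed

section \<open>Point absorbers as a low-rank perturbation\<close>

lemma identity_cols_carrier: "identity_cols N ks \<in> carrier_mat N (length ks)"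
  unfolding identity_cols_def using mat_of_cols_carrier(1) [of N "map (col (1\<^sub>m N)) ks"] by simp

lemma identity_cols_index:
  assumes "set ks \<subseteq> {..<N}" and "i < N" and "l < length ks"
  shows "identity_cols N ks $$ (i, l) = of_bool (i = ks ! l)"
proof -
  have "ks ! l < N" using assms by (meson lessThan_iff nth_mem subsetD)
  then show ?thesis
    using assms by (simp add: identity_cols_def mat_of_cols_index)
qed

text \<open>Entry (i, j) of the product counts the \<open>l\<close> for which \<open>ks ! l\<close>
  equals both i and j. It vanishes off the diagonal, and on it counts the absorbers at that
  vertex.\<close>

lemma potential_mat_point_absorbers:
  assumes "distinct vs" and "set ks \<subseteq> {..<length vs}"
  shows "potential_mat vs (\<lambda>x. \<kappa> * (\<Sum>l<length ks. indicator {vs ! (ks ! l)} x)) =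
    \<kappa> \<cdot>\<^sub>m (identity_cols (length vs) ks * transpose_mat (identity_cols (length vs) ks))"
    (is "potential_mat vs ?\<eta> = \<kappa> \<cdot>\<^sub>m (?U * transpose_mat ?U)")
proof (rule eq_matI)
  fix i j
  assume "i < dim_row (\<kappa> \<cdot>\<^sub>m (?U * transpose_mat ?U))"
    and "j < dim_col (\<kappa> \<cdot>\<^sub>m (?U * transpose_mat ?U))"
  then have ij: "i < length vs" "j < length vs"
    using identity_cols_carrier[of "length vs" ks] by auto
  have ks: "ks ! l < length vs" if "l < length ks" for l
    using that assms(2) by (meson lessThan_iff nth_mem subsetD)
  have "(?U * transpose_mat ?U) $$ (i, j) =
      (\<Sum>l<length ks. of_bool (i = ks ! l) * of_bool (j = ks ! l))"
    using ij identity_cols_carrier[of "length vs" ks] identity_cols_index[OF assms(2)]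
    by (auto simp: scalar_prod_def lessThan_atLeast0 intro!: sum.cong)
  \<comment> \<open>Distinctness of \<open>vs\<close> translates equality of vertices into equality
    of positions.\<close>
  also have "\<dots> = (if i = j then \<Sum>l<length ks. indicator {vs ! (ks ! l)} (vs ! i) else 0)"
    using ij ks nth_eq_iff_index_eq[OF assms(1)]
    by (auto simp: indicator_def intro!: sum.cong sum.neutral)
  finally show "potential_mat vs ?\<eta> $$ (i, j) = (\<kappa> \<cdot>\<^sub>m (?U * transpose_mat ?U)) $$ (i, j)"
    using ij identity_cols_carrier[of "length vs" ks]
    by (auto simp: potential_mat_def mat_diag_def)
qed (use identity_cols_carrier[of "length vs" ks] in \<open>auto simp: potential_mat_def mat_diag_def\<close>)

section \<open>The Green's function for point absorbers\<close>

text \<open>\<open>inverse_mat\<close> is meaningful only at invertible matrices, so invertibility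
  of \<open>H\<close> and of the bracket belongs to the claim.\<close>

theorem theorem12:
  fixes \<Gamma> :: "'a pair_pre_digraph" and V :: "'a set" and xs ys :: "'a list"
    and \<alpha>\<^sub>0 t \<kappa> :: real and ks :: "nat list" and \<eta> :: "'a \<Rightarrow> real"
    and H\<^sub>0 H G\<^sub>0 G I\<^sub>\<Lambda> :: "real mat"
  assumes "pair_bidirected_digraph \<Gamma>"
    and "Digraph_Component.connected (with_proj \<Gamma>)"
    and "locally_finite \<Gamma>"
    and "V \<noteq> {}" and "V \<subset> pverts \<Gamma>"
    and "finite V" and "finite (vertex_boundary \<Gamma> V)"
    and "distinct xs" and "set xs = V"
    and "distinct ys" and "set ys = vertex_boundary \<Gamma> V"
    and "\<alpha>\<^sub>0 > 0" and "t \<ge> 0"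
    and "H\<^sub>0 = background_operator \<Gamma> xs ys \<alpha>\<^sub>0 t"
    and "invertible_mat H\<^sub>0"
    and "\<kappa> > 0"
    and "distinct ks" and "set ks \<subseteq> {..<length xs}"
    and "\<eta> = (\<lambda>x. \<kappa> * (\<Sum>l<length ks. indicator {xs ! (ks ! l)} x))"
    and "H = H\<^sub>0 + \<alpha>\<^sub>0 \<cdot>\<^sub>m potential_mat (xs @ ys) \<eta>"
    and "G\<^sub>0 = inverse_mat H\<^sub>0"
    and "G = inverse_mat H"
    and "I\<^sub>\<Lambda> = identity_cols (card V + card (vertex_boundary \<Gamma> V)) ks"
  shows "invertible_mat H \<and>
    invertible_mat (1\<^sub>m (length ks) + (\<alpha>\<^sub>0 * \<kappa>) \<cdot>\<^sub>m (transpose_mat I\<^sub>\<Lambda> * G\<^sub>0 * I\<^sub>\<Lambda>)) \<and>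
    G\<^sub>0 - G = (\<alpha>\<^sub>0 * \<kappa>) \<cdot>\<^sub>m (G\<^sub>0 * I\<^sub>\<Lambda> *
      inverse_mat (1\<^sub>m (length ks) + (\<alpha>\<^sub>0 * \<kappa>) \<cdot>\<^sub>m (transpose_mat I\<^sub>\<Lambda> * G\<^sub>0 * I\<^sub>\<Lambda>)) *
      transpose_mat I\<^sub>\<Lambda> * G\<^sub>0)"
proof -
  let ?vs = "xs @ ys" and ?U = "I\<^sub>\<Lambda>" and ?c = "\<alpha>\<^sub>0 * \<kappa>"
  let ?N = "length ?vs" and ?m = "length ks"
  have N: "card V + card (vertex_boundary \<Gamma> V) = ?N"
    using assms(8-11) distinct_card by (metis length_append)
  have ys: "set ys = vertex_boundary \<Gamma> (set xs)" using assms(9,11) by simp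
  then have "set xs \<inter> set ys = {}" by (auto simp: vertex_boundary_def)
  then have vs: "distinct ?vs" using assms(8,10) by simp
  have ks: "ks ! l < length xs" if "l < ?m" for l
    using that assms(18) by (meson lessThan_iff nth_mem subsetD)
  have "\<eta> x = 0" if "x \<notin> set xs" for x
    using that ks by (auto simp: assms(19) indicator_def intro!: sum.neutral)
  moreover have "\<eta> x \<ge> 0" for x
    using assms(16) by (auto simp: assms(19) intro!: mult_nonneg_nonneg sum_nonneg)
  ultimately have invH: "invertible_mat H"
    using invertible_background_plus_potential[OF assms(1,8,10) ys assms(12,13), of \<eta>] assms(15)
    unfolding assms(20,14) by blast
  have U: "?U \<in> carrier_mat ?N ?m"
    unfolding assms(23) N by (rule identity_cols_carrier)
  \<comment> \<open>\<open>V\<close> is listed first, so a position in \<open>xs\<close> is the same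
    position in \<open>xs @ ys\<close>.\<close>
  have "\<eta> = (\<lambda>x. \<kappa> * (\<Sum>l<?m. indicator {?vs ! (ks ! l)} x))"
    unfolding assms(19) using ks by (simp add: nth_append)
  moreover have "set ks \<subseteq> {..<?N}" using assms(18) by auto
  ultimately have D: "potential_mat ?vs \<eta> = \<kappa> \<cdot>\<^sub>m (?U * transpose_mat ?U)"
    unfolding assms(23) N using potential_mat_point_absorbers[OF vs] by simp
  have UT: "transpose_mat ?U \<in> carrier_mat ?m ?N" using U by simp
  \<comment> \<open>The whole scalar goes into the right factor, so that the perturbation has the
    shape \<open>U * W\<close> of \<open>woodbury\<close>; it is pulled out again
    afterwards.\<close>
  define W where "W = ?c \<cdot>\<^sub>m transpose_mat ?U"
  have W: "W \<in> carrier_mat ?m ?N" using U by (simp add: W_def)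
  have "\<alpha>\<^sub>0 \<cdot>\<^sub>m potential_mat ?vs \<eta> = ?U * W"
    unfolding D W_def mult_smult_distrib[OF U UT] by (intro eq_matI) auto
  then have H: "H = H\<^sub>0 + ?U * W" unfolding assms(20) by simp
  have H\<^sub>0: "H\<^sub>0 \<in> carrier_mat ?N ?N"
    unfolding assms(14) background_operator_eq by (intro add_carrier_mat mat_diag_dim)
  note G\<^sub>0 = inverse_mat(1)[OF H\<^sub>0 assms(15), folded assms(21)]
  have "W * G\<^sub>0 * ?U = ?c \<cdot>\<^sub>m (transpose_mat ?U * G\<^sub>0 * ?U)"
    unfolding W_def using mult_smult_assoc_mat[OF UT G\<^sub>0, of ?c]
      mult_smult_assoc_mat[of "transpose_mat ?U * G\<^sub>0" ?m ?N ?U ?m ?c] UT G\<^sub>0 U by simp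
  then have M: "1\<^sub>m ?m + W * G\<^sub>0 * ?U = 1\<^sub>m ?m + ?c \<cdot>\<^sub>m (transpose_mat ?U * G\<^sub>0 * ?U)" (is "_ = ?M")
    by simp
  have invM: "invertible_mat ?M"
    and formula: "G\<^sub>0 - G = G\<^sub>0 * ?U * inverse_mat ?M * W * G\<^sub>0"
    using woodbury[OF H\<^sub>0 U W assms(15) invH[unfolded H]]
    unfolding assms(22) assms(21)[symmetric] H[symmetric] M by auto
  have "?M \<in> carrier_mat ?m ?m" using UT G\<^sub>0 U by simp
  then have "inverse_mat ?M \<in> carrier_mat ?m ?m" using invM by (rule inverse_mat(1))
  then have X: "G\<^sub>0 * ?U * inverse_mat ?M \<in> carrier_mat ?N ?m" using G\<^sub>0 U by simp
  \<comment> \<open>The scalar hidden in \<open>W\<close> moves to the front of the product.\<close>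
  have "G\<^sub>0 * ?U * inverse_mat ?M * W * G\<^sub>0 =
      ?c \<cdot>\<^sub>m (G\<^sub>0 * ?U * inverse_mat ?M * transpose_mat ?U * G\<^sub>0)"
    unfolding W_def mult_smult_distrib[OF X UT] using X UT G\<^sub>0
    by (intro mult_smult_assoc_mat) auto
  then show ?thesis using invH invM formula by simp
qed

end
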